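(* For every integer $n\ge 2$ there is a constant $C_n>0$, depending only on $n$, such that for every integer $d\ge 2$ the total number $\mathcal{A}_{d+1,n}$ of antichains in the $(d+1)$-dimensional box $[n]^{d+1}$ satisfies $$\mathcal{A}_{d+1,n}\le 2^{\left(1+\frac{C_n\log d}{\sqrt d}\right)N_{d+1,n}} .$$
   Context: Here $[n]=\{1,\ldots,n\}$, and $[n]^{d+1}$ is partially ordered coordinatewise: $x\preccurlyeq y$ iff $x_i\le y_i$ for all $1\le i\le d+1$. A subset $A\subset[n]^{d+1}$ is an antichain if no two distinct elements $x,y\in A$ satisfy $x\preccurlyeq y$ or $y\preccurlyeq x$ (the empty set counts as an antichain). $N_{d+1,n}$ denotes the cardinality of the middle layer of $[n]^{d+1}$, i.e. the number of $(x_1,\ldots,x_{d+1})\in[n]^{d+1}$ with $x_1+\cdots+x_{d+1}=\lfloor (d+1)(n+1)/2\rfloor$; this equals the size of a largest antichain in $[n]^{d+1}$. *)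

theory Defs
  imports Complex_Main "HOL-Library.FuncSet"
begin

text \<open>
  Points of $[n]^m$ are the functions from \<open>{1..m}\<close> to \<open>{1..n}\<close> that are
  \<open>undefined\<close> outside \<open>{1..m}\<close>, so that each point has exactly one representative
  and cardinalities of sets of points (and of sets of such sets) are the intended ones.
\<close>

definition grid :: "nat \<Rightarrow> nat \<Rightarrow> (nat \<Rightarrow> nat) set" where
  "grid m n = ({1..m} \<rightarrow>\<^sub>E {1..n})"

definition coord_le :: "nat \<Rightarrow> (nat \<Rightarrow> nat) \<Rightarrow> (nat \<Rightarrow> nat) \<Rightarrow> bool" where
  "coord_le m x y \<longleftrightarrow> (\<forall>i\<in>{1..m}. x i \<le> y i)"

definition antichain_in_grid :: "nat \<Rightarrow> nat \<Rightarrow> (nat \<Rightarrow> nat) set \<Rightarrow> bool" where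
  "antichain_in_grid m n A \<longleftrightarrow>
     A \<subseteq> grid m n \<and>
     (\<forall>x\<in>A. \<forall>y\<in>A. x \<noteq> y \<longrightarrow> \<not> coord_le m x y \<and> \<not> coord_le m y x)"

definition num_antichains :: "nat \<Rightarrow> nat \<Rightarrow> nat" where
  "num_antichains m n = card {A. antichain_in_grid m n A}"

text \<open>The middle layer; natural-number \<open>div\<close> supplies the floor.\<close>

definition middle_layer :: "nat \<Rightarrow> nat \<Rightarrow> (nat \<Rightarrow> nat) set" where
  "middle_layer m n = {x \<in> grid m n. (\<Sum>i\<in>{1..m}. x i) = (m * (n + 1)) div 2}"

definition middle_layer_size :: "nat \<Rightarrow> nat \<Rightarrow> nat" where
  "middle_layer_size m n = card (middle_layer m n)"

end

theory Submission
  imports Defs "HOL-Combinatorics.Permutations" "HOL-Real_Asymp.Real_Asymp" "HOL-Analysis.Convex"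
begin

text \<open>
  Write $m = d + 1$ and $N$ for the size of the middle layer. An antichain is an independent set of
  the comparability graph on the grid, so it suffices to count independent sets, and the bound
  follows once every set of vertices that is noticeably larger than $N$ is known to contain a vertex
  of large degree: deciding about such a vertex first either puts it into the independent set and
  thereby excludes many others, or discards it. Few decisions of the first kind are possible
  before at most $N + 2N/\sqrt d$ candidates are left, and these contribute at most
  $2^{N + 2N/\sqrt d}$ choices (\<open>card_indep_le\<close>).

  Large degrees come from symmetric chains. The grid splits into chains that all meet the middle
  layer, hence into at most $N$ chains. Permuting the coordinates gives a whole family of such
  partitions, indexed by the $m!$ permutations. For each of them, the Cauchy--Schwarz inequality
  yields at least $|S|(|S| - N)/N$ ordered pairs of distinct points of $S$ in a common chain.
  Conversely, a fixed pair $x \neq y$ shares a chain for at most a fraction $4n/m$ of the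
  permutations, provided that in $x$ and in $y$ each of the $n$ values occurs at least $m/(2n)$
  times (\<open>same_label_perms_balanced\<close>): up to exchanging the two points there is a
  large set of coordinates on which $x$ is constant and $y$ is not; permuting these coordinates
  fixes $x$ and produces linearly many different images of $y$ of the same rank, and the chain
  through $x$ contains at most one point of each rank. Double counting then gives a point of $S$
  comparable to at least $\frac{m}{4n} \cdot \frac{|S| - N}{N}$ others
  (\<open>comparable_supersaturation\<close>).

  The points in which some value is rare form an exponentially small part of the grid, and the
  grid has at most $nmN$ points, so these points may be distributed arbitrarily at a cost of
  $2^{o(N/\sqrt d)}$. Altogether the exponent is $(1 + O(1/\sqrt d + \log^2 d/d))N$, which is
  within the claimed bound once $d$ is large in terms of $n$. The finitely many remaining $d$ are
  absorbed into the constant by means of the trivial bound $2^{nmN}$.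
\<close>

section \<open>Symmetric chains in the grid\<close>

text \<open>
  The rank is normalised so that the all-ones point has rank \<open>0\<close>; with values in \<open>{1..n}\<close>
  the truncated subtraction is exact.
\<close>

definition rank_upto :: "(nat \<Rightarrow> nat) \<Rightarrow> nat \<Rightarrow> nat" where
  "rank_upto x k = (\<Sum>i\<in>{1..k}. x i - 1)"

text \<open>
  The label names the chain of a point in the symmetric chain decomposition of de Bruijn,
  Tengbergen and Kruyswijk, built up one coordinate at a time. Suppose that a prefix of length
  \<open>k\<close> lies at position $p$ of a chain of length $l$ (counted in steps). The product of this chain
  with the values of the next coordinate is a rectangle $\{0..l\} \times \{0..n-1\}$, which is cut
  into hooks: the hook number $t$ runs through $(0,t), \ldots, (l-t,t), (l-t,t+1), \ldots, (l-t,n-1)$.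
  The point $(p,j)$ lies on the hook $\min(j, l-p)$, and the label is the list of hook numbers.
  If $T$ is the sum of the hook numbers so far, the chain occupies the ranks from $T$ to
  $k(n-1) - T$; hence $p$ is the rank minus $T$, and $l - p$ is $k(n-1) - T$ minus the rank.
\<close>

primrec chain_label :: "nat \<Rightarrow> (nat \<Rightarrow> nat) \<Rightarrow> nat \<Rightarrow> nat list" where
  "chain_label n x 0 = []"
| "chain_label n x (Suc k) =
     min (x (Suc k) - 1) (k * (n - 1) - sum_list (chain_label n x k) - rank_upto x k)
       # chain_label n x k"

lemma rank_upto_0 [simp]: "rank_upto x 0 = 0"
  by (simp add: rank_upto_def)

lemma rank_upto_Suc [simp]: "rank_upto x (Suc k) = rank_upto x k + (x (Suc k) - 1)"
  by (simp add: rank_upto_def)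

lemma rank_upto_cong: "(\<And>i. i \<in> {1..k} \<Longrightarrow> x i = y i) \<Longrightarrow> rank_upto x k = rank_upto y k"
  unfolding rank_upto_def by (rule sum.cong) auto

lemma chain_label_cong:
  "(\<And>i. i \<in> {1..k} \<Longrightarrow> x i = y i) \<Longrightarrow> chain_label n x k = chain_label n y k"
proof (induction k)
  case (Suc k)
  have "rank_upto x k = rank_upto y k"
    by (rule rank_upto_cong) (use Suc.prems in auto)
  with Suc show ?case by simp
qed simp

text \<open>
  A chain whose hook numbers sum to $T$ lies between the rank $T$ and the opposite rank.
\<close>

lemma chain_label_bounds:
  assumes "\<And>i. i \<in> {1..k} \<Longrightarrow> x i \<in> {1..n}"
  shows "sum_list (chain_label n x k) \<le> rank_upto x k"
    and "sum_list (chain_label n x k) + rank_upto x k \<le> k * (n - 1)"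
proof -
  have "sum_list (chain_label n x k) \<le> rank_upto x k \<and>
        sum_list (chain_label n x k) + rank_upto x k \<le> k * (n - 1)"
    using assms
  proof (induction k)
    case (Suc k)
    have "x (Suc k) - 1 \<le> n - 1" using Suc.prems[of "Suc k"] by auto
    moreover have "sum_list (chain_label n x k) \<le> rank_upto x k \<and>
        sum_list (chain_label n x k) + rank_upto x k \<le> k * (n - 1)"
      using Suc by auto
    moreover have "min j (c - T - R) + T \<le> R + j \<and> min j (c - T - R) + T + (R + j) \<le> e + c"
      if "j \<le> e" "T \<le> R \<and> T + R \<le> c" for j e T R c :: nat
      using that by linarith
    ultimately show ?case by (simp del: diff_diff_left)
  qed simp
  then show "sum_list (chain_label n x k) \<le> rank_upto x k"
    and "sum_list (chain_label n x k) + rank_upto x k \<le> k * (n - 1)" by auto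
qed

text \<open>
  Points with a common label are ordered by rank because each hook first raises the position in
  the old chain and then the new coordinate, and never lowers either of them.
\<close>

lemma same_label_mono:
  assumes "\<And>i. i \<in> {1..k} \<Longrightarrow> x i \<in> {1..n}" "\<And>i. i \<in> {1..k} \<Longrightarrow> y i \<in> {1..n}"
    and "chain_label n x k = chain_label n y k" "rank_upto x k \<le> rank_upto y k"
  shows "\<forall>i\<in>{1..k}. x i \<le> y i"
  using assms
proof (induction k)
  case (Suc k)
  define c where "c = k * (n - 1) - sum_list (chain_label n y k)"
  have L: "chain_label n x k = chain_label n y k" using Suc.prems(3) by simp
  have x: "rank_upto x k \<le> c" "x (Suc k) \<ge> 1"
    using chain_label_bounds[of k x n] Suc.prems(1) L by (auto simp: c_def Suc_le_eq)
  have y: "rank_upto y k \<le> c" "y (Suc k) \<ge> 1"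
    using chain_label_bounds[of k y n] Suc.prems(2) by (auto simp: c_def Suc_le_eq)
  have "min (x (Suc k) - 1) (c - rank_upto x k) = min (y (Suc k) - 1) (c - rank_upto y k)"
    using Suc.prems(3) L by (simp add: c_def)
  moreover have "rank_upto x k + (x (Suc k) - 1) \<le> rank_upto y k + (y (Suc k) - 1)"
    using Suc.prems(4) by simp
  ultimately have "rank_upto x k \<le> rank_upto y k \<and> x (Suc k) \<le> y (Suc k)"
    using x y by (auto simp: min_def split: if_splits)
  moreover have "\<forall>i\<in>{1..k}. x i \<le> y i"
    using Suc.IH Suc.prems(1,2) L calculation by auto
  ultimately show ?case by (auto simp: le_Suc_eq)
qed simp

text \<open>
  Chains have no gaps: every rank between the two ends is attained. Since the ends are opposite
  ranks, every chain passes through the middle layer.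
\<close>

lemma chain_meets_rank:
  assumes "\<And>i. i \<in> {1..k} \<Longrightarrow> x i \<in> {1..n}"
    and "sum_list (chain_label n x k) \<le> r" "r + sum_list (chain_label n x k) \<le> k * (n - 1)"
  shows "\<exists>y. (\<forall>i\<in>{1..k}. y i \<in> {1..n}) \<and> chain_label n y k = chain_label n x k \<and> rank_upto y k = r"
  using assms
proof (induction k arbitrary: r)
  case (Suc k)
  define T where "T = sum_list (chain_label n x k)"
  define c where "c = k * (n - 1) - T"
  define t where "t = min (x (Suc k) - 1) (c - rank_upto x k)"
  have b: "T \<le> rank_upto x k" "T + rank_upto x k \<le> k * (n - 1)"
    using chain_label_bounds[of k x n] Suc.prems(1) by (auto simp: T_def)
  have xk: "x (Suc k) - 1 \<le> n - 1" "1 \<le> n" using Suc.prems(1)[of "Suc k"] by auto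
  have r: "t + T \<le> r" "r + (t + T) \<le> n - 1 + k * (n - 1)"
    using Suc.prems(2,3) by (simp_all add: t_def c_def T_def)
  have c: "r + t \<le> n - 1 + c" using r(2) b by (simp add: c_def)
  have t: "t \<le> n - 1" "t + T \<le> c" using b xk by (auto simp: t_def c_def)
  \<comment> \<open>Follow the old chain with the last coordinate at \<open>t\<close>, then raise the last coordinate.\<close>
  obtain R j where Rj: "R + j = r" "T \<le> R" "R \<le> c" "j \<le> n - 1" "min j (c - R) = t"
  proof (cases "r \<le> c")
    case True
    show ?thesis by (rule that[of "r - t" t]) (use True r t in auto)
  next
    case False
    show ?thesis by (rule that[of "c - t" "r - c + t"]) (use False c t in \<open>auto simp: min_def\<close>)
  qed
  have "R + T \<le> k * (n - 1)" using Rj b c_def by linarith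
  then obtain y where y: "\<forall>i\<in>{1..k}. y i \<in> {1..n}" "chain_label n y k = chain_label n x k"
      "rank_upto y k = R"
    using Suc.IH[of R] Suc.prems(1) Rj by (auto simp: T_def)
  define z where "z = y(Suc k := Suc j)"
  have z: "chain_label n z k = chain_label n x k" "rank_upto z k = R"
    using chain_label_cong[of k z y n] rank_upto_cong[of k z y] y by (auto simp: z_def)
  have "\<forall>i\<in>{1..Suc k}. z i \<in> {1..n}"
    using y(1) Rj(4) xk by (auto simp: z_def le_Suc_eq)
  moreover have "chain_label n z (Suc k) = chain_label n x (Suc k)"
    using z Rj(5) by (simp add: t_def c_def T_def) (simp add: z_def)
  moreover have "rank_upto z (Suc k) = r"
    using z Rj(1) by (simp add: z_def)
  ultimately show ?case by blast
qed simp

lemma finite_grid [simp]: "finite (grid m n)"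
  by (simp add: grid_def finite_PiE)

lemma grid_D: "x \<in> grid m n \<Longrightarrow> i \<in> {1..m} \<Longrightarrow> x i \<in> {1..n}"
  by (auto simp: grid_def)

lemma rank_upto_grid:
  assumes "x \<in> grid m n"
  shows "rank_upto x m + m = (\<Sum>i\<in>{1..m}. x i)"
proof -
  have "(\<Sum>i\<in>{1..m}. x i) = (\<Sum>i\<in>{1..m}. (x i - 1) + 1)"
    by (rule sum.cong) (use grid_D[OF assms] in \<open>auto simp: Suc_le_eq\<close>)
  also have "\<dots> = rank_upto x m + m" unfolding rank_upto_def by (subst sum.distrib) simp
  finally show ?thesis by simp
qed

lemma same_label_comparable:
  assumes "x \<in> grid m n" "y \<in> grid m n" "chain_label n x m = chain_label n y m"
  shows "coord_le m x y \<or> coord_le m y x"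
proof (cases "rank_upto x m \<le> rank_upto y m")
  case True
  then show ?thesis
    using same_label_mono[of m x n y] grid_D[OF assms(1)] grid_D[OF assms(2)] assms(3)
    by (simp add: coord_le_def)
next
  case False
  then show ?thesis
    using same_label_mono[of m y n x] grid_D[OF assms(1)] grid_D[OF assms(2)] assms(3)
    by (simp add: coord_le_def)
qed

lemma same_label_same_rank_eq:
  assumes "x \<in> grid m n" "y \<in> grid m n" "chain_label n x m = chain_label n y m"
    and "rank_upto x m = rank_upto y m"
  shows "x = y"
proof -
  have "\<forall>i\<in>{1..m}. x i \<le> y i" "\<forall>i\<in>{1..m}. y i \<le> x i"
    using same_label_mono[of m x n y] same_label_mono[of m y n x] assms grid_D by auto
  then show ?thesis
    using assms(1,2) unfolding grid_def by (intro PiE_ext) (auto intro: le_antisym)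
qed

text \<open>
  Each chain has a point in the middle layer, so there are at most as many chains as points there.
\<close>

lemma card_chain_labels_le:
  assumes "n \<ge> 1"
  shows "card ((\<lambda>x. chain_label n x m) ` grid m n) \<le> middle_layer_size m n"
proof -
  have "(\<lambda>x. chain_label n x m) ` grid m n \<subseteq> (\<lambda>x. chain_label n x m) ` middle_layer m n"
  proof (rule image_subsetI)
    fix x assume x: "x \<in> grid m n"
    let ?T = "sum_list (chain_label n x m)"
    have "2 * ?T \<le> m * (n - 1)"
      using chain_label_bounds[of m x n] grid_D[OF x] by force
    then obtain y where y: "\<forall>i\<in>{1..m}. y i \<in> {1..n}" "chain_label n y m = chain_label n x m"
        "rank_upto y m = m * (n - 1) div 2"
      using chain_meets_rank[of m x n "m * (n - 1) div 2"] grid_D[OF x] by force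
    define z where "z = restrict y {1..m}"
    have zg: "z \<in> grid m n" using y(1) by (auto simp: z_def grid_def)
    have z: "chain_label n z m = chain_label n x m" "rank_upto z m = m * (n - 1) div 2"
      using chain_label_cong[of m z y n] rank_upto_cong[of m z y] y by (auto simp: z_def)
    have "m * (n + 1) = m * (n - 1) + m * 2"
      using assms by (simp flip: add_mult_distrib2)
    then have "m * (n + 1) div 2 = m * (n - 1) div 2 + m" by simp
    then have "z \<in> middle_layer m n"
      using rank_upto_grid[OF zg] z(2) zg by (simp add: middle_layer_def)
    then show "chain_label n x m \<in> (\<lambda>x. chain_label n x m) ` middle_layer m n"
      using z(1) by (metis image_eqI)
  qed
  moreover have "finite (middle_layer m n)" by (simp add: middle_layer_def)
  ultimately show ?thesis unfolding middle_layer_size_def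
    by (meson surj_card_le)
qed

text \<open>
  A point is determined by its chain and its rank, which takes at most $m(n-1) + 1 \le nm$ values.
\<close>

lemma card_grid_le_middle_layer:
  assumes "n \<ge> 1" "m \<ge> 1"
  shows "n ^ m \<le> middle_layer_size m n * (n * m)"
proof -
  let ?f = "\<lambda>x. (chain_label n x m, rank_upto x m)"
  let ?L = "(\<lambda>x. chain_label n x m) ` grid m n"
  have "inj_on ?f (grid m n)"
    by (rule inj_onI) (use same_label_same_rank_eq in auto)
  moreover have "?f ` grid m n \<subseteq> ?L \<times> {0..m * (n - 1)}"
  proof (rule image_subsetI)
    fix x assume x: "x \<in> grid m n"
    then have "rank_upto x m \<le> m * (n - 1)"
      using chain_label_bounds(2)[of m x n, OF grid_D[OF x]] by linarith
    with x show "?f x \<in> ?L \<times> {0..m * (n - 1)}" by simp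
  qed
  ultimately have "card (grid m n) \<le> card (?L \<times> {0..m * (n - 1)})"
    by (intro card_inj_on_le) auto
  also have "\<dots> \<le> middle_layer_size m n * (m * (n - 1) + 1)"
    unfolding card_cartesian_product using card_chain_labels_le[OF assms(1)]
    by (intro mult_mono) auto
  also have "\<dots> \<le> middle_layer_size m n * (n * m)"
  proof (rule mult_left_mono)
    obtain n' where "n = Suc n'" using assms(1) by (cases n) auto
    then show "m * (n - 1) + 1 \<le> n * m" using assms(2) by (simp add: algebra_simps)
  qed simp
  finally show ?thesis by (simp add: grid_def card_PiE)
qed

section \<open>Permuted chain decompositions\<close>

text \<open>
  Each permutation of the coordinates carries the chain decomposition to another one. The set
  collects the permutations for which \<open>x\<close> and \<open>y\<close> lie in a common chain.
\<close>

definition same_label_perms :: "nat \<Rightarrow> nat \<Rightarrow> (nat \<Rightarrow> nat) \<Rightarrow> (nat \<Rightarrow> nat) \<Rightarrow> (nat \<Rightarrow> nat) set" where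
  "same_label_perms n m x y =
     {p. p permutes {1..m} \<and> chain_label n (x \<circ> p) m = chain_label n (y \<circ> p) m}"

lemma grid_permute:
  assumes "x \<in> grid m n" "p permutes {1..m}"
  shows "x \<circ> p \<in> grid m n"
proof -
  have "\<And>i. i \<in> {1..m} \<Longrightarrow> p i \<in> {1..m}" "\<And>i. i \<notin> {1..m} \<Longrightarrow> p i = i"
    using permutes_in_image[OF assms(2)] permutes_not_in[OF assms(2)] by auto
  with assms(1) show ?thesis by (auto simp: grid_def PiE_iff extensional_def)
qed

lemma rank_upto_permute:
  assumes "p permutes {1..m}"
  shows "rank_upto (x \<circ> p) m = rank_upto x m"
  unfolding rank_upto_def using sum.permute[OF assms, of "\<lambda>i. x i - 1"] by (simp add: o_def)

lemma finite_same_label_perms [simp]: "finite (same_label_perms n m x y)"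
  by (rule finite_subset[OF _ finite_permutations[of "{1..m}"]]) (auto simp: same_label_perms_def)

lemma same_label_perms_commute: "same_label_perms n m x y = same_label_perms n m y x"
  by (auto simp: same_label_perms_def)

lemma same_label_perms_comparable:
  assumes "x \<in> grid m n" "y \<in> grid m n" "same_label_perms n m x y \<noteq> {}"
  shows "coord_le m x y \<or> coord_le m y x"
proof -
  obtain p where p: "p permutes {1..m}" "chain_label n (x \<circ> p) m = chain_label n (y \<circ> p) m"
    using assms(3) by (auto simp: same_label_perms_def)
  have "coord_le m (x \<circ> p) (y \<circ> p) \<or> coord_le m (y \<circ> p) (x \<circ> p)"
    using same_label_comparable grid_permute assms p by blast
  moreover have "coord_le m u v" if "coord_le m (u \<circ> p) (v \<circ> p)" for u v
  proof -
    have "\<forall>j\<in>p ` {1..m}. u j \<le> v j" using that by (simp add: coord_le_def)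
    then show ?thesis unfolding permutes_image[OF p(1)] coord_le_def .
  qed
  ultimately show ?thesis by blast
qed

text \<open>
  The transpositions of \<open>a\<close> with the elements of \<open>J\<close> fix \<open>x\<close> and send \<open>y\<close> to pairwise different points
  of equal rank. Hence, for a given permutation $q$, at most one of these images can share its
  chain with \<open>x\<close> after composing with $q$. In other words, the translates of \<open>same_label_perms n m x y\<close>
  by the transpositions are disjoint sets of permutations.
\<close>

lemma transposed_same_label_perms:
  assumes "x \<in> grid m n" "y \<in> grid m n" "a \<in> {1..m}" "J \<subseteq> {1..m}"
    and "\<And>j. j \<in> J \<Longrightarrow> x j = x a" "\<And>j. j \<in> J \<Longrightarrow> y j \<noteq> y a"
  shows "card J * card (same_label_perms n m x y) \<le> fact m"
proof -
  let ?B = "same_label_perms n m x y"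
  let ?f = "\<lambda>(j, p). transpose a j \<circ> p"
  have tr: "transpose a j permutes {1..m}" if "j \<in> J" for j
    using that assms(3,4) by (intro permutes_swap_id) auto
  have xt: "x \<circ> transpose a j = x" if "j \<in> J" for j
    using assms(5)[OF that] by (auto simp: transpose_def)
  have inj: "inj_on ?f (J \<times> ?B)"
  proof (rule inj_onI, clarsimp)
    fix j p j' p'
    assume j: "j \<in> J" "j' \<in> J" and p: "p \<in> ?B" "p' \<in> ?B"
      and eq: "transpose a j \<circ> p = transpose a j' \<circ> p'"
    define q where "q = transpose a j \<circ> p"
    have pq: "p = transpose a j \<circ> q" "p' = transpose a j' \<circ> q"
      unfolding q_def by (simp add: o_assoc) (simp only: eq o_assoc transpose_comp_involutory id_comp)
    have q: "q permutes {1..m}"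
      using p(1) tr[OF j(1)] by (auto simp: q_def same_label_perms_def intro: permutes_compose)
    have g: "(y \<circ> transpose a i) \<circ> q \<in> grid m n" if "i \<in> J" for i
      by (intro grid_permute assms q tr that)
    have "chain_label n (x \<circ> q) m = chain_label n ((y \<circ> transpose a j) \<circ> q) m"
      using p(1) xt[OF j(1)] by (simp add: same_label_perms_def pq(1) o_assoc)
    moreover have "chain_label n (x \<circ> q) m = chain_label n ((y \<circ> transpose a j') \<circ> q) m"
      using p(2) xt[OF j(2)] by (simp add: same_label_perms_def pq(2) o_assoc)
    moreover have "rank_upto ((y \<circ> transpose a i) \<circ> q) m = rank_upto y m" if "i \<in> J" for i
      using rank_upto_permute[OF q] rank_upto_permute[OF tr[OF that]] by simp
    ultimately have "(y \<circ> transpose a j) \<circ> q = (y \<circ> transpose a j') \<circ> q"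
      using same_label_same_rank_eq[OF g[OF j(1)] g[OF j(2)]] j by simp
    then have "y \<circ> transpose a j = y \<circ> transpose a j'"
      using permutes_surj[OF q] by (metis fun.map_id0 o_assoc surj_iff comp_id)
    then have "(y \<circ> transpose a j) j = (y \<circ> transpose a j') j" by simp
    moreover have "j \<noteq> a" using assms(6)[OF j(1)] by auto
    ultimately have "j = j'" using assms(6)[OF j(1)] by (auto simp: transpose_def split: if_splits)
    with pq show "j = j' \<and> p = p'" by simp
  qed
  have sub: "?f ` (J \<times> ?B) \<subseteq> {p. p permutes {1..m}}"
    using tr by (auto simp: same_label_perms_def intro: permutes_compose)
  have "card (J \<times> ?B) \<le> card {p. p permutes {1..m}}"
    using card_inj_on_le[OF inj sub] finite_permutations[of "{1..m}"] by simp
  then show ?thesis by (simp add: card_cartesian_product card_permutations)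
qed

text \<open>
  If \<open>y\<close> takes different values at two places \<open>a\<close>, \<open>b\<close> of a level set of \<open>x\<close>, then every place of
  the level set differs in \<open>y\<close> from \<open>a\<close> or from \<open>b\<close>, so it can be swapped with one of the two.
\<close>

lemma same_label_perms_level_set:
  assumes "x \<in> grid m n" "y \<in> grid m n" "a \<in> {1..m}" "b \<in> {1..m}" "x a = x b" "y a \<noteq> y b"
  shows "card {i \<in> {1..m}. x i = x a} * card (same_label_perms n m x y) \<le> 2 * fact m"
proof -
  let ?I = "{i \<in> {1..m}. x i = x a}"
  let ?A = "{i \<in> ?I. y i \<noteq> y a}" and ?B = "{i \<in> ?I. y i \<noteq> y b}"
  \<comment> \<open>The two sets may be very uneven, but bounding both by the previous lemma avoids choosing the larger one.\<close>
  have "card ?I \<le> card (?A \<union> ?B)" using assms(6) by (intro card_mono) auto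
  also have "\<dots> \<le> card ?A + card ?B" by (rule card_Un_le)
  finally have "card ?I * card (same_label_perms n m x y)
      \<le> (card ?A + card ?B) * card (same_label_perms n m x y)" by (rule mult_right_mono) simp
  also have "\<dots> \<le> fact m + fact m"
    unfolding add_mult_distrib using assms
    by (intro add_mono transposed_same_label_perms[of x m n y a] transposed_same_label_perms[of x m n y b]) auto
  finally show ?thesis by simp
qed

text \<open>
  An injective self-map of a finite set is a rearrangement, so it preserves the sum of the values.
\<close>

lemma injective_raising_eq_id:
  fixes \<phi> :: "nat \<Rightarrow> nat"
  assumes "inj_on \<phi> {1..n}" "\<phi> ` {1..n} \<subseteq> {1..n}" "\<And>v. v \<in> {1..n} \<Longrightarrow> v \<le> \<phi> v" "v \<in> {1..n}"
  shows "\<phi> v = v"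
proof (rule ccontr)
  assume "\<phi> v \<noteq> v"
  then have "v < \<phi> v" using assms(3,4) by (simp add: le_neq_implies_less)
  then have "(\<Sum>v\<in>{1..n}. v) < (\<Sum>v\<in>{1..n}. \<phi> v)"
    using assms(3,4) by (intro sum_strict_mono_ex1) auto
  also have "\<phi> ` {1..n} = {1..n}" using assms(1,2) by (simp only: endo_inj_surj finite_atLeastAtMost)
  then have "(\<Sum>v\<in>{1..n}. \<phi> v) = (\<Sum>v\<in>{1..n}. v)"
    using sum.reindex[OF assms(1), of "\<lambda>v. v"] by simp
  finally show False by simp
qed

text \<open>
  If \<open>x\<close> and \<open>y\<close> had the same level sets, then \<open>y\<close> would arise from \<open>x\<close> by renaming values injectively
  and, by comparability, without lowering any of them. As \<open>x\<close> takes all values, such a renaming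
  is the identity.
\<close>

lemma comparable_split_level_set:
  assumes "x \<in> grid m n" "y \<in> grid m n" "coord_le m x y" "x \<noteq> y"
    and "x ` {1..m} = {1..n}"
  shows "\<exists>a\<in>{1..m}. \<exists>b\<in>{1..m}. (x a = x b) \<noteq> (y a = y b)"
proof (rule ccontr)
  assume "\<not> ?thesis"
  then have same: "x a = x b \<longleftrightarrow> y a = y b" if "a \<in> {1..m}" "b \<in> {1..m}" for a b
    using that by blast
  define r where "r = inv_into {1..m} x"
  have r: "r v \<in> {1..m}" "x (r v) = v" if "v \<in> {1..n}" for v
    using that inv_into_into[of v x "{1..m}"] f_inv_into_f[of v x "{1..m}"]
    unfolding r_def assms(5) by auto
  have yr: "y (r v) = v" if "v \<in> {1..n}" for v
  proof (rule injective_raising_eq_id[where \<phi> = "\<lambda>v. y (r v)"])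
    show "inj_on (\<lambda>v. y (r v)) {1..n}"
      by (rule inj_onI) (use same r in metis)
    show "(\<lambda>v. y (r v)) ` {1..n} \<subseteq> {1..n}" using grid_D[OF assms(2)] r by blast
    show "v \<le> y (r v)" if "v \<in> {1..n}" for v
      using assms(3) r[OF that] unfolding coord_le_def by metis
  qed (rule that)
  have "x i = y i" if "i \<in> {1..m}" for i
    using same[OF that r(1)[OF grid_D[OF assms(1) that]]] r(2) yr grid_D[OF assms(1) that] by simp
  then show False using assms(1,2,4) unfolding grid_def by (metis PiE_ext)
qed

text \<open>
  On average every value occurs $m/n$ times; balanced points keep half of this for each value.
\<close>

definition balanced :: "nat \<Rightarrow> nat \<Rightarrow> (nat \<Rightarrow> nat) set" where
  "balanced m n = {x \<in> grid m n. \<forall>v\<in>{1..n}. real m / (2 * real n) \<le> card {i \<in> {1..m}. x i = v}}"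

text \<open>
  Points sharing a chain are comparable, so either some level set of \<open>x\<close> is split by \<open>y\<close> or some
  level set of \<open>y\<close> is split by \<open>x\<close>. All these level sets have at least $m/(2n)$ elements.
\<close>

lemma same_label_perms_balanced:
  assumes "x \<in> balanced m n" "y \<in> balanced m n" "x \<noteq> y" "m \<ge> 1" "n \<ge> 1"
  shows "real m / (4 * real n) * card (same_label_perms n m x y) \<le> fact m"
proof -
  have g: "x \<in> grid m n" "y \<in> grid m n" using assms by (auto simp: balanced_def)
  have onto: "z ` {1..m} = {1..n}" if z: "z \<in> balanced m n" for z
  proof
    show "{1..n} \<subseteq> z ` {1..m}"
    proof
      fix v assume v: "v \<in> {1..n}"
      have "0 < real m / (2 * real n)" using assms by simp
      also have "\<dots> \<le> card {i \<in> {1..m}. z i = v}" using z v by (auto simp: balanced_def)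
      finally have "card {i \<in> {1..m}. z i = v} \<noteq> 0" by (metis less_irrefl of_nat_0)
      then have "{i \<in> {1..m}. z i = v} \<noteq> {}" by (metis card.empty)
      then show "v \<in> z ` {1..m}" by blast
    qed
  qed (use z in \<open>auto simp: balanced_def dest: grid_D\<close>)
  have main: "real m / (4 * real n) * card (same_label_perms n m u w) \<le> fact m"
    if u: "u \<in> balanced m n" and w: "w \<in> grid m n" and ab: "a \<in> {1..m}" "b \<in> {1..m}"
      "u a = u b" "w a \<noteq> w b" for u w a b
  proof -
    have ug: "u \<in> grid m n" using u by (simp add: balanced_def)
    have "real m / (2 * real n) \<le> card {i \<in> {1..m}. u i = u a}"
      using u grid_D[OF ug ab(1)] by (simp add: balanced_def)
    then have "real m / (2 * real n) * card (same_label_perms n m u w)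
        \<le> real (card {i \<in> {1..m}. u i = u a} * card (same_label_perms n m u w))"
      unfolding of_nat_mult by (rule mult_right_mono) simp
    also have "\<dots> \<le> real (2 * fact m)"
      using same_label_perms_level_set[OF ug w ab] by (simp only: of_nat_le_iff)
    finally show ?thesis by simp
  qed
  show ?thesis
  proof (cases "same_label_perms n m x y = {}")
    case False
    then have "\<exists>a\<in>{1..m}. \<exists>b\<in>{1..m}. (x a = x b) \<noteq> (y a = y b)"
      using same_label_perms_comparable[OF g] comparable_split_level_set[OF g]
        comparable_split_level_set[OF g(2,1)] onto assms by metis
    then show ?thesis
      using main[OF assms(1) g(2)] main[OF assms(2) g(1)] same_label_perms_commute by metis
  qed simp
qed

section \<open>Supersaturation of comparable pairs\<close>

definition comparable :: "nat \<Rightarrow> (nat \<Rightarrow> nat) \<Rightarrow> (nat \<Rightarrow> nat) \<Rightarrow> bool" where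
  "comparable m x y \<longleftrightarrow> x \<noteq> y \<and> (coord_le m x y \<or> coord_le m y x)"

text \<open>
  The Cauchy--Schwarz inequality for the sizes of the fibres of \<open>f\<close>.
\<close>

lemma card_square_le_equal_pairs:
  fixes f :: "'a \<Rightarrow> 'b"
  assumes "finite S" "card (f ` S) \<le> N"
  shows "(card S)\<^sup>2 \<le> N * card {(x, y). x \<in> S \<and> y \<in> S \<and> f x = f y}"
proof -
  let ?F = "\<lambda>l. {x \<in> S. f x = l}"
  have S: "card S = (\<Sum>l\<in>f ` S. card (?F l))"
  proof -
    have "S = (\<Union>l\<in>f ` S. ?F l)" by auto
    then have "card S = card (\<Union>l\<in>f ` S. ?F l)" by simp
    also have "\<dots> = (\<Sum>l\<in>f ` S. card (?F l))"
      using assms(1) by (intro card_UN_disjoint) auto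
    finally show ?thesis .
  qed
  have P: "card {(x, y). x \<in> S \<and> y \<in> S \<and> f x = f y} = (\<Sum>l\<in>f ` S. (card (?F l))\<^sup>2)"
  proof -
    have "{(x, y). x \<in> S \<and> y \<in> S \<and> f x = f y} = (\<Union>l\<in>f ` S. ?F l \<times> ?F l)" by auto
    then have "card {(x, y). x \<in> S \<and> y \<in> S \<and> f x = f y} = card (\<Union>l\<in>f ` S. ?F l \<times> ?F l)"
      by simp
    also have "\<dots> = (\<Sum>l\<in>f ` S. card (?F l \<times> ?F l))"
      using assms(1) by (intro card_UN_disjoint) auto
    finally show ?thesis by (simp add: card_cartesian_product power2_eq_square)
  qed
  have "(\<Sum>l\<in>f ` S. real (card (?F l)))\<^sup>2 \<le> (\<Sum>l\<in>f ` S. (real (card (?F l)))\<^sup>2) * card (f ` S)"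
    using sum_squared_le_sum_of_squares[of "\<lambda>l. real (card (?F l))" "f ` S"] by simp
  also have "\<dots> \<le> (\<Sum>l\<in>f ` S. (real (card (?F l)))\<^sup>2) * N"
    using assms(2) by (intro mult_left_mono sum_nonneg) auto
  finally have "real ((card S)\<^sup>2) \<le> real (N * card {(x, y). x \<in> S \<and> y \<in> S \<and> f x = f y})"
    unfolding P by (simp add: S mult.commute)
  then show ?thesis by (simp only: of_nat_le_iff)
qed

lemma sum_max_degree:
  assumes "finite S" "S \<noteq> {}"
  shows "\<exists>v\<in>S. card {(x, y). x \<in> S \<and> y \<in> S \<and> E x y} \<le> card S * card {y \<in> S. E v y}"
proof -
  let ?d = "\<lambda>x. card {y \<in> S. E x y}"
  have "Max (?d ` S) \<in> ?d ` S" using assms by simp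
  then obtain v where "v \<in> S" "?d v = Max (?d ` S)" by auto
  then have v: "v \<in> S" "\<And>x. x \<in> S \<Longrightarrow> ?d x \<le> ?d v" using assms(1) by auto
  have "{(x, y). x \<in> S \<and> y \<in> S \<and> E x y} = Sigma S (\<lambda>x. {y \<in> S. E x y})" by auto
  then have "card {(x, y). x \<in> S \<and> y \<in> S \<and> E x y} = (\<Sum>x\<in>S. card {y \<in> S. E x y})"
    using assms(1) by simp
  also have "\<dots> \<le> of_nat (card S) * card {y \<in> S. E v y}" by (intro sum_bounded_above v(2))
  finally show ?thesis using v(1) by auto
qed

text \<open>
  Count the triples of a permutation and two distinct points of \<open>S\<close> that the permutation puts into a
  common chain. Every permutation contributes many pairs, since there are at most \<open>N\<close> chains, while
  every pair is contributed by few permutations and is comparable. So \<open>S\<close> contains many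
  comparable pairs, and an average vertex has the stated degree.
\<close>

lemma comparable_supersaturation:
  assumes "S \<subseteq> balanced m n" "S \<noteq> {}" "m \<ge> 1" "n \<ge> 1"
  defines "N \<equiv> middle_layer_size m n"
  shows "\<exists>v\<in>S. real m / (4 * real n) * (real (card S) - real N) \<le> real N * card {y \<in> S. comparable m v y}"
proof -
  let ?P = "{p. p permutes {1..m}}"
  let ?\<kappa> = "real m / (4 * real n)"
  let ?C = "{(x, y). x \<in> S \<and> y \<in> S \<and> comparable m x y}"
  have Sg: "S \<subseteq> grid m n" using assms(1) by (auto simp: balanced_def)
  then have fin: "finite S" by (rule finite_subset) simp
  have finP: "finite ?P" by (rule finite_permutations) simp
  have finC: "finite ?C" by (rule finite_subset[of _ "S \<times> S"]) (use fin in auto)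
  define Q where "Q p = {(x, y). x \<in> S \<and> y \<in> S \<and> x \<noteq> y \<and>
      chain_label n (x \<circ> p) m = chain_label n (y \<circ> p) m}" for p
  have finQ: "finite (Q p)" for p
    by (rule finite_subset[of _ "S \<times> S"]) (use fin in \<open>auto simp: Q_def\<close>)
  have many: "real (card S) * (real (card S) - real N) \<le> real N * card (Q p)" if p: "p \<in> ?P" for p
  proof -
    let ?f = "\<lambda>x. chain_label n (x \<circ> p) m"
    have "?f ` S \<subseteq> (\<lambda>x. chain_label n x m) ` grid m n"
      using Sg p grid_permute by blast
    then have "card (?f ` S) \<le> N"
      using card_chain_labels_le[OF assms(4), of m] card_mono[of "(\<lambda>x. chain_label n x m) ` grid m n"]
      unfolding N_def by (meson finite_grid finite_imageI order_trans)
    then have "(card S)\<^sup>2 \<le> N * card {(x, y). x \<in> S \<and> y \<in> S \<and> ?f x = ?f y}"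
      by (rule card_square_le_equal_pairs[OF fin])
    also have "{(x, y). x \<in> S \<and> y \<in> S \<and> ?f x = ?f y} = (\<lambda>x. (x, x)) ` S \<union> Q p"
      by (auto simp: Q_def)
    also have "card \<dots> \<le> card S + card (Q p)"
      using card_Un_le[of "(\<lambda>x. (x, x)) ` S" "Q p"] card_image_le[OF fin, of "\<lambda>x. (x, x)"] by linarith
    finally have "(card S)\<^sup>2 \<le> N * (card S + card (Q p))" by simp
    then have "real ((card S)\<^sup>2) \<le> real (N * (card S + card (Q p)))" by (simp only: of_nat_le_iff)
    then show ?thesis by (simp add: algebra_simps power2_eq_square)
  qed
  \<comment> \<open>Exchange the order of summation over permutations and pairs.\<close>
  have count: "(\<Sum>p\<in>?P. card (Q p)) = (\<Sum>z\<in>?C. card (same_label_perms n m (fst z) (snd z)))"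
  proof -
    have "Sigma ?P Q = (\<lambda>(z, p). (p, z)) ` (SIGMA z:?C. same_label_perms n m (fst z) (snd z))"
    proof (intro equalityI subsetI)
      fix w assume "w \<in> Sigma ?P Q"
      then obtain p x y where w: "w = (p, x, y)" "p permutes {1..m}" "x \<in> S" "y \<in> S" "x \<noteq> y"
          "chain_label n (x \<circ> p) m = chain_label n (y \<circ> p) m"
        by (auto simp: Q_def)
      then have "p \<in> same_label_perms n m x y" by (simp add: same_label_perms_def)
      moreover from this have "comparable m x y"
        using same_label_perms_comparable[of x m n y] w Sg by (auto simp: comparable_def)
      ultimately show "w \<in> (\<lambda>(z, p). (p, z)) ` (SIGMA z:?C. same_label_perms n m (fst z) (snd z))"
        using w by (intro image_eqI[of _ _ "((x, y), p)"]) auto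
    qed (auto simp: Q_def same_label_perms_def comparable_def)
    moreover have "inj_on (\<lambda>(z, p). (p, z)) (SIGMA z:?C. same_label_perms n m (fst z) (snd z))"
      by (auto simp: inj_on_def)
    ultimately have "card (Sigma ?P Q) = card (SIGMA z:?C. same_label_perms n m (fst z) (snd z))"
      by (simp add: card_image)
    then show ?thesis using finP finC finQ by simp
  qed
  have "real (fact m) * (?\<kappa> * (card S * (real (card S) - real N)))
      = ?\<kappa> * (\<Sum>p\<in>?P. real (card S) * (real (card S) - real N))"
    by (simp add: card_permutations)
  also have "\<dots> \<le> ?\<kappa> * (\<Sum>p\<in>?P. real N * card (Q p))"
    by (intro mult_left_mono sum_mono many) auto
  also have "\<dots> = real N * (?\<kappa> * real (\<Sum>p\<in>?P. card (Q p)))"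
    by (simp add: sum_distrib_left mult_ac)
  also have "\<dots> = real N * (\<Sum>z\<in>?C. ?\<kappa> * card (same_label_perms n m (fst z) (snd z)))"
    unfolding count by (simp only: of_nat_sum sum_distrib_left)
  also have "\<dots> \<le> real N * (\<Sum>z\<in>?C. fact m)"
    using assms(1,3,4)
    by (intro mult_left_mono sum_mono same_label_perms_balanced) (auto simp: comparable_def)
  also have "\<dots> = real (fact m) * (real N * card ?C)" by simp
  finally have pairs: "?\<kappa> * (card S * (real (card S) - real N)) \<le> real N * card ?C"
    by (subst (asm) mult_le_cancel_left_pos) auto
  obtain v where v: "v \<in> S" "card ?C \<le> card S * card {y \<in> S. comparable m v y}"
    using sum_max_degree[OF fin assms(2), of "comparable m"] by auto
  have "real (card S) * (?\<kappa> * (real (card S) - real N)) \<le> real N * card ?C"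
    using pairs by (simp add: mult_ac)
  also have "\<dots> \<le> real N * real (card S * card {y \<in> S. comparable m v y})"
    using v(2) by (intro mult_left_mono) (simp_all only: of_nat_le_iff of_nat_0_le_iff)
  also have "\<dots> = real (card S) * (real N * card {y \<in> S. comparable m v y})" by simp
  finally have "?\<kappa> * (real (card S) - real N) \<le> real N * card {y \<in> S. comparable m v y}"
    using assms(2) fin by (subst (asm) mult_le_cancel_left_pos) (auto simp: card_gt_0_iff)
  with v(1) show ?thesis by blast
qed

section \<open>Independent sets in graphs with large degrees\<close>

definition indep :: "('a \<Rightarrow> 'a \<Rightarrow> bool) \<Rightarrow> 'a set \<Rightarrow> 'a set set" where
  "indep E S = {A. A \<subseteq> S \<and> (\<forall>x\<in>A. \<forall>y\<in>A. \<not> E x y)}"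

lemma finite_indep: "finite S \<Longrightarrow> finite (indep E S)"
  by (rule finite_subset[of _ "Pow S"]) (auto simp: indep_def)

lemma card_indep_le_power: "finite S \<Longrightarrow> card (indep E S) \<le> 2 ^ card S"
  using card_mono[of "Pow S" "indep E S"] by (auto simp: indep_def card_Pow)

text \<open>
  An independent set either avoids \<open>v\<close>, or avoids all neighbours of \<open>v\<close>.
\<close>

lemma card_indep_step:
  assumes "finite S"
  shows "card (indep E S) \<le> card (indep E (S - {v})) + card (indep E (S - {y \<in> S. E v y}))"
proof -
  let ?A = "{A \<in> indep E S. v \<notin> A}" and ?B = "{A \<in> indep E S. v \<in> A}"
  have "indep E S = ?A \<union> ?B" by auto
  then have "card (indep E S) \<le> card ?A + card ?B" using card_Un_le[of ?A ?B] by simp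
  also have "card ?A \<le> card (indep E (S - {v}))"
    using assms by (intro card_mono finite_indep) (auto simp: indep_def)
  also have "card ?B \<le> card (indep E (S - {y \<in> S. E v y}))"
    using assms by (intro card_mono finite_indep) (auto simp: indep_def)
  finally show ?thesis by simp
qed

lemma one_minus_powr_le_exp:
  fixes z L :: real
  assumes "z < 1" "L \<ge> 0"
  shows "(1 - z) powr L \<le> exp (- (z * L))"
proof -
  have "L * ln (1 - z) \<le> L * (- z)"
    using assms ln_add_one_self_le_self2[of "-z"] by (intro mult_left_mono) auto
  then show ?thesis using assms by (simp add: powr_def mult.commute)
qed

text \<open>
  The degree hypothesis says that a set exceeding the threshold \<open>N\<close> by \<open>u\<close> has a vertex \<open>v\<close> whose
  neighbourhood makes up at least a fraction \<open>\<kappa> / N\<close> of the excess. Putting \<open>v\<close> into the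
  independent set therefore multiplies the excess by at most \<open>1 - \<kappa> / N\<close>, and leaving \<open>v\<close> out
  multiplies it by \<open>1 - 1 / u\<close>. A power \<open>L\<close> of the excess turns these factors into
  exponentials whose sum is at most \<open>1\<close>, so such a power dominates the recursion in the preceding
  lemma. The recursion stops when the excess is at most \<open>2 * w\<close>, where all subsets are counted.
  The unit of measurement \<open>w\<close> is half of that, so that the truncation at \<open>1\<close> does not interfere
  with a step from just above the stopping point: neither factor is below one half there.
\<close>

lemma card_indep_le:
  fixes V :: "'a set" and N \<kappa> w L U :: real
  assumes "finite V" "N > 0" "0 \<le> \<kappa>" "\<kappa> \<le> N / 2" "w \<ge> 1" "L \<ge> 0" "real (card V) \<le> U"
    and degree: "\<And>S. S \<subseteq> V \<Longrightarrow> S \<noteq> {} \<Longrightarrow> \<exists>v\<in>S. \<kappa> * (card S - N) \<le> N * card {y \<in> S. E v y}"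
    and small: "exp (- (L / U)) + exp (- (\<kappa> * L / N)) \<le> 1"
    and "S \<subseteq> V"
  shows "card (indep E S) \<le> 2 powr (N + 2 * w) * max 1 ((card S - N) / w) powr L"
  using \<open>S \<subseteq> V\<close>
proof (induction "card S" arbitrary: S rule: less_induct)
  case less
  let ?g = "\<lambda>u. 2 powr (N + 2 * w) * max 1 (u / w) powr L"
  have fin: "finite S" using less.prems assms(1) by (rule finite_subset)
  have g_mono: "?g u \<le> ?g u'" if "u \<le> u'" for u u'
    using that assms(5,6) by (intro mult_left_mono powr_mono2 max.mono divide_right_mono) auto
  show ?case
  proof (cases "card S \<le> N + 2 * w")
    case True
    have "real (card (indep E S)) \<le> 2 ^ card S"
      using card_indep_le_power[OF fin, of E] by (metis of_nat_le_iff of_nat_numeral of_nat_power)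
    also have "\<dots> = 2 powr card S" by (simp add: powr_realpow)
    also have "\<dots> \<le> 2 powr (N + 2 * w)" using True by simp
    also have "\<dots> \<le> ?g (card S - N)" using assms(6) by (simp add: ge_one_powr_ge_zero)
    finally show ?thesis .
  next
    case False
    define u where "u = card S - N"
    have u: "u > 2 * w" using False by (simp add: u_def)
    have "card S > 0" using False assms(2,5) by (cases "card S = 0") auto
    then have "S \<noteq> {}" by auto
    then obtain v where v: "v \<in> S" "\<kappa> * u \<le> N * card {y \<in> S. E v y}"
      using degree[OF less.prems] by (auto simp: u_def)
    let ?D = "{y \<in> S. E v y}"
    have gu: "?g u = 2 powr (N + 2 * w) * (u / w) powr L"
      using u assms(5) by (simp add: max_def field_simps)
    have c1: "real (card (S - {v})) = real (card S) - 1"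
      using arg_cong[OF card_Suc_Diff1[OF fin v(1)], of real] unfolding of_nat_Suc by linarith
    have "card (indep E (S - {v})) \<le> ?g (card (S - {v}) - N)"
      using v(1) fin less.prems by (intro less.hyps card_Diff1_less) auto
    also have "card (S - {v}) - N = u - 1" using c1 unfolding u_def by linarith
    also have "max 1 ((u - 1) / w) = (u / w) * (1 - 1 / u)"
      using u assms(5) by (simp add: max_def field_simps)
    also have "2 powr (N + 2 * w) * ((u / w) * (1 - 1 / u)) powr L
        = 2 powr (N + 2 * w) * ((u / w) powr L * (1 - 1 / u) powr L)"
      using u assms(5) by (subst powr_mult) auto
    also have "\<dots> = ?g u * (1 - 1 / u) powr L"
      unfolding gu by simp
    also have "\<dots> \<le> ?g u * exp (- (1 / u * L))"
      using u assms(5,6) by (intro mult_left_mono one_minus_powr_le_exp) auto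
    also have "\<dots> \<le> ?g u * exp (- (L / U))"
    proof -
      have "card S \<le> card V" using less.prems assms(1) by (intro card_mono)
      then have "u \<le> U" using assms(2,7) by (simp add: u_def)
      then have "L / U \<le> L / u" using u assms(5,6) by (intro divide_left_mono mult_pos_pos) auto
      then show ?thesis by (intro mult_left_mono) auto
    qed
    finally have 1: "card (indep E (S - {v})) \<le> ?g u * exp (- (L / U))" .
    have kN: "\<kappa> / N \<le> 1 / 2" using assms(2,4) by (simp add: field_simps)
    then have kN1: "\<kappa> / N < 1" by linarith
    have 2: "card (indep E (S - ?D)) \<le> ?g u * exp (- (\<kappa> * L / N))"
    proof (cases "?D = {}")
      case True
      then have "\<kappa> * u \<le> 0" using v(2) unfolding True card.empty by simp
      \<comment> \<open>Without neighbours the set does not shrink; this forces \<open>\<kappa> = 0\<close>, where the hypothesis on the exponentials fails.\<close>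
      then have "\<kappa> = 0" using u assms(3,5) by (simp add: mult_le_0_iff)
      with small assms(2) show ?thesis by (simp add: not_le[symmetric])
    next
      case False
      have "card ?D \<le> card S" using fin by (intro card_mono) auto
      then have c2: "real (card (S - ?D)) = real (card S) - real (card ?D)"
        using fin by (subst card_Diff_subset) (auto simp: of_nat_diff)
      have "card (indep E (S - ?D)) \<le> ?g (card (S - ?D) - N)"
        using False fin less.prems by (intro less.hyps psubset_card_mono) auto
      also have "\<dots> \<le> ?g (u * (1 - \<kappa> / N))"
        using v(2) assms(2) by (intro g_mono) (simp add: c2 u_def field_simps)
      also have "\<dots> = 2 powr (N + 2 * w) * ((u / w) * (1 - \<kappa> / N)) powr L"
      proof -
        \<comment> \<open>The truncation at \<open>1\<close> is inactive, as the excess was more than \<open>2 * w\<close> and at most halves in the bound.\<close>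
        have "2 * (1 / 2) \<le> (u / w) * (1 - \<kappa> / N)"
          using u kN assms(5) by (intro mult_mono) (auto simp: field_simps)
        then show ?thesis by (simp add: max_def)
      qed
      also have "\<dots> = ?g u * (1 - \<kappa> / N) powr L"
        unfolding gu using u kN assms(5) by (subst powr_mult) auto
      also have "\<dots> \<le> ?g u * exp (- (\<kappa> / N * L))"
        using kN1 assms(6) by (intro mult_left_mono one_minus_powr_le_exp) auto
      finally show ?thesis by simp
    qed
    have "real (card (indep E S)) \<le> card (indep E (S - {v})) + card (indep E (S - ?D))"
      using card_indep_step[OF fin, of E v] by linarith
    also have "\<dots> \<le> ?g u * (exp (- (L / U)) + exp (- (\<kappa> * L / N)))"
      using 1 2 by (simp add: distrib_left)
    also have "\<dots> \<le> ?g u * 1" using small by (intro mult_left_mono) auto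
    finally show ?thesis by (simp add: u_def)
  qed
qed

section \<open>Points with a rare value\<close>

text \<open>
  An exponential moment bound: weight every point by $2^{-c}$, where $c$ is the number of
  occurrences of \<open>v\<close>. The total weight factorises over the coordinates, and points with $c < t$
  have weight at least $2^{-t}$.
\<close>

lemma card_rare_value_le:
  assumes "v \<in> {1..n}"
  shows "card {x \<in> grid m n. real (card {i \<in> {1..m}. x i = v}) < t} \<le> 2 powr t * (real n - 1 / 2) ^ m"
proof -
  let ?c = "\<lambda>x::nat \<Rightarrow> nat. card {i \<in> {1..m}. x i = v}"
  let ?R = "{x \<in> grid m n. real (?c x) < t}"
  have "real (card ?R) = (\<Sum>x\<in>?R. 1)" by simp
  also have "\<dots> \<le> (\<Sum>x\<in>?R. 2 powr t * (1 / 2) ^ ?c x)"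
  proof (rule sum_mono)
    fix x assume "x \<in> ?R"
    then have "(2::real) powr 0 \<le> 2 powr (t - ?c x)" by (intro powr_mono) auto
    also have "2 powr (t - ?c x) = 2 powr t * (1 / 2) ^ ?c x"
      by (simp only: powr_diff powr_realpow power_one_over) simp
    finally show "1 \<le> 2 powr t * (1 / 2) ^ ?c x" by simp
  qed
  also have "\<dots> \<le> (\<Sum>x\<in>grid m n. 2 powr t * (1 / 2) ^ ?c x)"
    by (intro sum_mono2) auto
  also have "\<dots> = 2 powr t * (\<Sum>x\<in>grid m n. \<Prod>i\<in>{1..m}. if x i = v then 1 / 2 else 1)"
    by (simp add: sum_distrib_left prod.If_cases Int_def)
  also have "(\<Sum>x\<in>grid m n. \<Prod>i\<in>{1..m}. if x i = v then 1 / 2 else (1::real))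
      = (\<Prod>i\<in>{1..m}. \<Sum>a\<in>{1..n}. if a = v then 1 / 2 else 1)"
    unfolding grid_def by (rule prod_sum_PiE[symmetric]) auto
  also have "(\<Sum>a\<in>{1..n}. if a = v then 1 / 2 else (1::real)) = real n - 1 / 2"
  proof -
    have "(\<Sum>a\<in>{1..n}. if a = v then 1 / 2 else (1::real)) = 1 / 2 + (\<Sum>a\<in>{1..n} - {v}. 1)"
      using assms by (subst sum.remove[of _ v]) (auto intro!: sum.cong)
    also have "\<dots> = real n - 1 / 2" using assms by (simp add: of_nat_diff)
    finally show ?thesis .
  qed
  finally show ?thesis by simp
qed

lemma unbalanced_base:
  fixes n :: nat
  assumes "n \<ge> 1"
  shows "0 < 1 - 1 / (4 * real n ^ 2)" "1 - 1 / (4 * real n ^ 2) < 1"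
proof -
  have "1 \<le> real n ^ 2" using assms by simp
  then have "1 < 4 * real n ^ 2" by linarith
  then show "0 < 1 - 1 / (4 * real n ^ 2)" "1 - 1 / (4 * real n ^ 2) < 1"
    using assms by (simp_all add: pos_divide_less_eq)
qed

text \<open>
  With $t = m/(2n)$ the loss $2^t$ is at most $(1 + \frac{1}{2n})^m$ by Bernoulli's inequality,
  which the gain $(1 - \frac{1}{2n})^m$ outweighs.
\<close>

lemma card_unbalanced_le:
  assumes "n \<ge> 1"
  shows "card (grid m n - balanced m n) \<le> n * (1 - 1 / (4 * real n ^ 2)) ^ m * real n ^ m"
proof -
  let ?t = "real m / (2 * real n)"
  let ?R = "\<lambda>v. {x \<in> grid m n. real (card {i \<in> {1..m}. x i = v}) < ?t}"
  have "grid m n - balanced m n \<subseteq> (\<Union>v\<in>{1..n}. ?R v)"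
    by (auto simp: balanced_def not_le)
  then have "card (grid m n - balanced m n) \<le> card (\<Union>v\<in>{1..n}. ?R v)"
    by (intro card_mono) auto
  also have "\<dots> \<le> (\<Sum>v\<in>{1..n}. card (?R v))" by (rule card_UN_le) simp
  finally have "real (card (grid m n - balanced m n)) \<le> (\<Sum>v\<in>{1..n}. real (card (?R v)))"
    by (simp only: of_nat_le_iff flip: of_nat_sum)
  also have "\<dots> \<le> (\<Sum>v\<in>{1..n}. 2 powr ?t * (real n - 1 / 2) ^ m)"
    by (intro sum_mono card_rare_value_le)
  also have "\<dots> = n * (2 powr (1 / (2 * n)) * (real n - 1 / 2)) ^ m"
  proof -
    have "2 powr ?t = (2 powr (1 / (2 * n))) ^ m" by (simp add: powr_power)
    then show ?thesis by (simp add: power_mult_distrib)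
  qed
  also have "\<dots> \<le> n * ((1 + 1 / (2 * n)) * (real n - 1 / 2)) ^ m"
  proof -
    have "2 powr (1 / (2 * real n)) \<le> 1 + 1 / (2 * n)"
    proof -
      have "1 + (2 * n) * (1 / (2 * real n)) \<le> (1 + 1 / (2 * real n)) ^ (2 * n)"
        using Bernoulli_inequality[of "1 / (2 * real n)" "2 * n"] by (simp add: order_trans[of _ 0])
      then have "2 \<le> (1 + 1 / (2 * real n)) ^ (2 * n)" using assms by simp
      then have "2 powr (1 / (2 * real n)) \<le> ((1 + 1 / (2 * real n)) ^ (2 * n)) powr (1 / (2 * real n))"
        by (intro powr_mono2) auto
      also have "\<dots> = ((1 + 1 / (2 * real n)) powr (2 * n)) powr (1 / (2 * real n))"
        by (subst powr_realpow) (auto intro: add_pos_nonneg)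
      also have "\<dots> = 1 + 1 / (2 * n)" using assms by (simp add: powr_powr)
      finally show ?thesis .
    qed
    then show ?thesis using assms by (intro mult_left_mono power_mono mult_right_mono mult_nonneg_nonneg) auto
  qed
  also have "(1 + 1 / (2 * n)) * (real n - 1 / 2) = (1 - 1 / (4 * real n ^ 2)) * n"
    using assms by (simp add: field_simps power2_eq_square)
  finally show ?thesis by (simp add: power_mult_distrib mult_ac)
qed

section \<open>Counting antichains\<close>

lemma num_antichains_eq: "num_antichains m n = card (indep (comparable m) (grid m n))"
  unfolding num_antichains_def indep_def antichain_in_grid_def comparable_def
  by (rule arg_cong[where f = card]) auto

text \<open>
  Used to discard the unbalanced points: an independent set is determined by its traces inside and
  outside \<open>W\<close>.
\<close>

lemma card_indep_split:
  assumes "finite V" "W \<subseteq> V"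
  shows "card (indep E V) \<le> 2 ^ card (V - W) * card (indep E W)"
proof -
  let ?f = "\<lambda>A. (A - W, A \<inter> W)"
  have "inj_on ?f (indep E V)" by (rule inj_onI) auto
  moreover have "?f ` indep E V \<subseteq> Pow (V - W) \<times> indep E W" by (auto simp: indep_def)
  moreover have "finite W" using assms by (rule finite_subset[rotated])
  ultimately have "card (indep E V) \<le> card (Pow (V - W) \<times> indep E W)"
    using assms by (intro card_inj_on_le[of ?f]) (auto simp: finite_indep)
  then show ?thesis using assms by (simp add: card_cartesian_product card_Pow)
qed

lemma num_antichains_trivial:
  assumes "n \<ge> 1" "m \<ge> 1"
  shows "real (num_antichains m n) \<le> 2 powr (real n * m * middle_layer_size m n)"
proof -
  have "num_antichains m n \<le> 2 ^ card (grid m n)"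
    unfolding num_antichains_eq by (rule card_indep_le_power) simp
  also have "card (grid m n) = n ^ m" by (simp add: grid_def card_PiE)
  also have "(2::nat) ^ n ^ m \<le> 2 ^ (middle_layer_size m n * (n * m))"
    by (intro power_increasing card_grid_le_middle_layer assms) auto
  finally have "real (num_antichains m n) \<le> real (2 ^ (middle_layer_size m n * (n * m)))"
    by (simp only: of_nat_le_iff)
  also have "\<dots> = 2 powr (real n * m * middle_layer_size m n)"
    by (simp flip: powr_realpow add: mult_ac)
  finally show ?thesis .
qed

text \<open>
  The exponent $L = 16 n N \ln m / m$ is chosen for \<open>\<kappa> = m / (4 n)\<close> so that $\kappa L / N = 4 \ln m$: taking a vertex
  reduces the potential by the factor $m^{-4}$, while leaving it out multiplies it by at most
  $\exp(- 16 \ln m / m^2)$, because the excess never exceeds $nmN$.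
\<close>

lemma num_antichains_le:
  assumes "n \<ge> 1" "m \<ge> 1" "w \<ge> 1"
  defines "N \<equiv> real (middle_layer_size m n)"
  assumes "real m / (4 * real n) \<le> N / 2" "w \<le> real n * real m * N"
    and "exp (- (16 * ln m / real m ^ 2)) + exp (- (4 * ln m)) \<le> 1"
  shows "real (num_antichains m n) \<le>
    2 powr (n * (1 - 1 / (4 * real n ^ 2)) ^ m * (real n * real m * N) + (N + 2 * w))
      * (real n * real m * N / w) powr (16 * real n * N * ln m / m)"
proof -
  let ?B = "balanced m n" and ?L = "16 * real n * N * ln m / m"
  have Npos: "N > 0" 
  proof -
    have "0 < real m / (4 * real n)" using assms(1,2) by simp
    then show ?thesis using assms(5) by linarith
  qed
  have sub: "?B \<subseteq> grid m n" by (auto simp: balanced_def)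
  have "real (n ^ m) \<le> real (middle_layer_size m n * (n * m))"
    using card_grid_le_middle_layer[OF assms(1,2)] by (simp only: of_nat_le_iff)
  then have grid: "real n ^ m \<le> real n * real m * N" by (simp add: N_def mult_ac)
  have "card ?B \<le> card (grid m n)" by (intro card_mono sub) simp
  also have "\<dots> = n ^ m" by (simp add: grid_def card_PiE)
  finally have "real (card ?B) \<le> real (n ^ m)" by (simp only: of_nat_le_iff)
  then have B: "real (card ?B) \<le> real n * real m * N" using grid unfolding of_nat_power by linarith
  have "real (num_antichains m n) \<le> real (2 ^ card (grid m n - ?B) * card (indep (comparable m) ?B))"
    unfolding num_antichains_eq of_nat_le_iff by (rule card_indep_split[OF finite_grid sub])
  also have "\<dots> = 2 powr card (grid m n - ?B) * real (card (indep (comparable m) ?B))"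
    by (simp add: powr_realpow)
  also have "\<dots> \<le> 2 powr (n * (1 - 1 / (4 * real n ^ 2)) ^ m * (real n * real m * N))
      * (2 powr (N + 2 * w) * max 1 ((card ?B - N) / w) powr ?L)"
  proof (rule mult_mono)
    have "real (card (grid m n - ?B)) \<le> n * (1 - 1 / (4 * real n ^ 2)) ^ m * real n ^ m"
      by (rule card_unbalanced_le) fact
    also have "\<dots> \<le> n * (1 - 1 / (4 * real n ^ 2)) ^ m * (real n * real m * N)"
      using unbalanced_base[OF assms(1)]
      by (intro mult_left_mono grid mult_nonneg_nonneg zero_le_power) auto
    finally show "2 powr real (card (grid m n - ?B))
        \<le> 2 powr (n * (1 - 1 / (4 * real n ^ 2)) ^ m * (real n * real m * N))" by simp
    show "real (card (indep (comparable m) ?B)) \<le> 2 powr (N + 2 * w) * max 1 ((card ?B - N) / w) powr ?L"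
    proof (rule card_indep_le[where V = ?B and \<kappa> = "real m / (4 * real n)" and U = "real n * real m * N"])
      show "finite ?B" using sub by (rule finite_subset) simp
      show "\<exists>v\<in>S. real m / (4 * real n) * (card S - N) \<le> N * card {y \<in> S. comparable m v y}"
        if "S \<subseteq> ?B" "S \<noteq> {}" for S
        unfolding N_def by (intro comparable_supersaturation that assms)
      have "?L / (real n * real m * N) = 16 * ln m / real m ^ 2" "real m / (4 * real n) * ?L / N = 4 * ln m"
        using Npos assms(1,2) by (simp_all add: field_simps power2_eq_square)
      then show "exp (- (?L / (real n * real m * N))) + exp (- (real m / (4 * real n) * ?L / N)) \<le> 1"
        using assms(7) by simp
    qed (use Npos assms B in auto)
  qed auto
  also have "\<dots> \<le> 2 powr (n * (1 - 1 / (4 * real n ^ 2)) ^ m * (real n * real m * N))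
      * (2 powr (N + 2 * w) * (real n * real m * N / w) powr ?L)"
  proof -
    have "max 1 ((card ?B - N) / w) \<le> real n * real m * N / w"
    proof (rule max.boundedI)
      show "1 \<le> real n * real m * N / w" using assms(3,6) by simp
      show "(card ?B - N) / w \<le> real n * real m * N / w"
        using assms(3) B Npos by (intro divide_right_mono) auto
    qed
    then show ?thesis using Npos assms(2) by (intro mult_left_mono powr_mono2) auto
  qed
  finally show ?thesis by (simp add: powr_add mult_ac)
qed

section \<open>Asymptotics\<close>

text \<open>
  The three terms of the error are the cost of the unbalanced points, the slack $2w = 2N/\sqrt d$
  at which the recursion stops, and the cost of the recursion itself, all relative to $N$.
\<close>

lemma eventually_error_le:
  fixes n :: nat
  assumes "n \<ge> 2"
  defines "e \<equiv> \<lambda>d. real n * (1 - 1 / (4 * real n ^ 2)) ^ (d + 1) * (real n * real (d + 1)) + 2 / sqrt d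
    + 16 * real n * ln (real (d + 1)) / real (d + 1) * log 2 (real n * real (d + 1) * sqrt d)"
  shows "\<forall>\<^sub>F d in sequentially. e d \<le> ln (real d) / sqrt (real d)"
proof -
  define q where "q = 1 - 1 / (4 * real n ^ 2)"
  define c where "c = real n"
  have q: "0 < q" "q < 1" using unbalanced_base[of n] assms(1) by (auto simp: q_def)
  have c: "0 < c" using assms(1) by (simp add: c_def)
  have "(\<lambda>d::nat. (c * q ^ (d + 1) * (c * (d + 1)) + 2 / sqrt d
    + 16 * c * ln (d + 1) / (d + 1) * log 2 (c * (d + 1) * sqrt d)) / (ln (real d) / sqrt (real d))) \<longlonglongrightarrow> 0"
    using q c by real_asymp
  then have "\<forall>\<^sub>F d in sequentially. e d / (ln (real d) / sqrt (real d)) < 1"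
    by (intro order_tendstoD(2)[of _ 0]) (simp_all add: e_def q_def c_def algebra_simps)
  moreover have "\<forall>\<^sub>F d::nat in sequentially. 0 < ln (real d) / sqrt (real d)" by real_asymp
  ultimately show ?thesis by eventually_elim (simp add: divide_simps split: if_splits)
qed

lemma eventually_step_ok: "\<forall>\<^sub>F d::nat in sequentially.
   exp (- (16 * ln (real (d + 1)) / real (d + 1) ^ 2)) + exp (- (4 * ln (real (d + 1)))) \<le> 1"
  by real_asymp

lemma eventually_middle_large:
  fixes n :: nat assumes "n \<ge> 2"
  shows "\<forall>\<^sub>F d::nat in sequentially. real (d + 1) \<le> real n ^ (d + 1) / (real n * real (d + 1))"
  using assms by real_asymp

lemma num_antichains_le_of_large:
  fixes n d :: nat
  assumes "n \<ge> 2" "d \<ge> 2"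
    and error: "real n * (1 - 1 / (4 * real n ^ 2)) ^ (d + 1) * (real n * real (d + 1)) + 2 / sqrt d
      + 16 * real n * ln (real (d + 1)) / real (d + 1) * log 2 (real n * real (d + 1) * sqrt d) \<le> ln (real d) / sqrt (real d)"
    and step: "exp (- (16 * ln (real (d + 1)) / real (d + 1) ^ 2)) + exp (- (4 * ln (real (d + 1)))) \<le> 1"
    and large: "real (d + 1) \<le> real n ^ (d + 1) / (real n * real (d + 1))"
  shows "real (num_antichains (d + 1) n)
    \<le> 2 powr ((1 + ln (real d) / sqrt (real d)) * real (middle_layer_size (d + 1) n))"
proof -
  define m where "m = d + 1"
  define N where "N = real (middle_layer_size m n)"
  define q where "q = 1 - 1 / (4 * real n ^ 2)"
  have "real (n ^ m) \<le> real (middle_layer_size m n * (n * m))"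
    using card_grid_le_middle_layer[of n m] assms(1) by (simp only: of_nat_le_iff) (simp add: m_def)
  then have "real n ^ m \<le> N * (real n * m)" unfolding N_def of_nat_power of_nat_mult .
  moreover have "0 < real n * m" using assms(1) by (simp add: m_def)
  ultimately have "real n ^ m / (real n * m) \<le> N" by (simp only: pos_divide_le_eq)
  then have N: "real m \<le> N" using large by (simp add: m_def)
  have "sqrt d \<le> d" using assms(2) by (simp add: sqrt_le_D real_le_lsqrt power2_eq_square)
  then have d: "sqrt d \<le> N" "1 \<le> sqrt d" using N assms(2) by (simp_all add: m_def)
  have Npos: "0 < N" using N by (simp add: m_def)
  have nm: "1 \<le> real n * m"
    using assms(1) mult_mono[of 1 "real n" 1 "real m"] by (simp add: m_def)
  let ?X = "real n * real m * sqrt d" and ?Y = "16 * real n * N * ln m / m"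
  have "real (num_antichains m n) \<le> 2 powr (n * q ^ m * (real n * real m * N) + (N + 2 * (N / sqrt d)))
      * (real n * real m * N / (N / sqrt d)) powr ?Y"
    unfolding N_def q_def
  proof (rule num_antichains_le)
    show "1 \<le> real (middle_layer_size m n) / sqrt d" using d by (simp add: N_def)
    have "real m / (4 * real n) \<le> real m / 2"
      using assms(1) by (intro divide_left_mono) auto
    then show "real m / (4 * real n) \<le> real (middle_layer_size m n) / 2"
      using N by (simp add: N_def)
    have "N / sqrt d \<le> 1 * N" using d Npos by (simp add: field_simps)
    also have "\<dots> \<le> real n * real m * N" using nm Npos by (intro mult_right_mono) auto
    finally show "real (middle_layer_size m n) / sqrt d \<le> real n * real m * real (middle_layer_size m n)"
      by (simp add: N_def)
  qed (use assms step in \<open>simp_all add: m_def\<close>)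
  also have "real n * real m * N / (N / sqrt d) = ?X" using Npos by simp
  also have "?X powr ?Y = 2 powr (log 2 ?X * ?Y)"
    using assms(1,2) by (subst powr_powr[symmetric]) (simp add: m_def)
  also have "2 powr (n * q ^ m * (real n * real m * N) + (N + 2 * (N / sqrt d))) * 2 powr (log 2 ?X * ?Y)
      = 2 powr ((1 + (n * q ^ m * (real n * real m) + 2 / sqrt d + 16 * real n * ln m / m * log 2 ?X)) * N)"
    by (simp flip: powr_add add: algebra_simps)
  also have "\<dots> \<le> 2 powr ((1 + ln (real d) / sqrt (real d)) * N)"
    using error Npos by (intro powr_mono mult_right_mono add_left_mono) (simp_all add: m_def q_def mult_ac)
  finally show ?thesis by (simp add: m_def N_def)
qed

theorem theorem1p2:
  shows "\<forall>n::nat. n \<ge> 2 \<longrightarrow>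
    (\<exists>C::real. C > 0 \<and>
      (\<forall>d::nat. d \<ge> 2 \<longrightarrow>
        real (num_antichains (d + 1) n)
          \<le> 2 powr ((1 + C * ln (real d) / sqrt (real d)) * real (middle_layer_size (d + 1) n))))"
proof (intro allI impI)
  fix n :: nat
  assume n: "n \<ge> 2"
  have "\<forall>\<^sub>F d in sequentially. d \<ge> 2 \<longrightarrow> real (num_antichains (d + 1) n)
      \<le> 2 powr ((1 + ln (real d) / sqrt (real d)) * real (middle_layer_size (d + 1) n))"
    using eventually_error_le[OF n] eventually_step_ok eventually_middle_large[OF n]
    by eventually_elim (intro impI num_antichains_le_of_large[OF n])
  then obtain D where D: "\<And>d. d \<ge> D \<Longrightarrow> d \<ge> 2 \<Longrightarrow> real (num_antichains (d + 1) n)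
      \<le> 2 powr ((1 + ln (real d) / sqrt (real d)) * real (middle_layer_size (d + 1) n))"
    unfolding eventually_sequentially by blast
  \<comment> \<open>This makes the trivial bound suffice for \<open>d < D\<close>, as then \<open>ln d / sqrt d \<ge> ln 2 / sqrt D\<close>.\<close>
  define C where "C = 1 + n * (D + 1) * sqrt D / ln 2"
  have C: "C \<ge> 1" by (simp add: C_def)
  have "real (num_antichains (d + 1) n)
      \<le> 2 powr ((1 + C * ln (real d) / sqrt (real d)) * real (middle_layer_size (d + 1) n))"
    if d: "d \<ge> 2" for d
  proof (cases "d \<ge> D")
    case True
    have "ln (real d) / sqrt (real d) \<le> C * ln (real d) / sqrt (real d)"
      using C d by (intro divide_right_mono) (auto simp: mult_le_cancel_right1)
    then have "2 powr ((1 + ln (real d) / sqrt (real d)) * real (middle_layer_size (d + 1) n))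
        \<le> 2 powr ((1 + C * ln (real d) / sqrt (real d)) * real (middle_layer_size (d + 1) n))"
      by (intro powr_mono mult_right_mono) auto
    with D[OF True d] show ?thesis by linarith
  next
    case False
    have "real n * (d + 1) \<le> (n * (D + 1) * sqrt D / ln 2) * (ln 2 / sqrt D)"
    proof -
      have "real n * (d + 1) \<le> real n * (D + 1)" using False by (intro mult_left_mono) auto
      also have "\<dots> = (n * (D + 1) * sqrt D / ln 2) * (ln 2 / sqrt D)" using False
        by (simp add: field_simps)
      finally show ?thesis .
    qed
    also have "\<dots> \<le> C * (ln d / sqrt d)"
      using False d by (intro mult_mono frac_le) (auto simp: C_def)
    finally have "real n * (d + 1) \<le> 1 + C * ln d / sqrt d" by simp
    then have "2 powr (real n * (d + 1) * middle_layer_size (d + 1) n)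
        \<le> 2 powr ((1 + C * ln (real d) / sqrt (real d)) * real (middle_layer_size (d + 1) n))"
      by (intro powr_mono mult_right_mono) auto
    moreover have "real (num_antichains (d + 1) n)
        \<le> 2 powr (real n * (d + 1) * middle_layer_size (d + 1) n)"
      by (rule num_antichains_trivial) (use n in auto)
    ultimately show ?thesis by linarith
  qed
  with C show "\<exists>C::real. C > 0 \<and> (\<forall>d::nat. d \<ge> 2 \<longrightarrow> real (num_antichains (d + 1) n)
      \<le> 2 powr ((1 + C * ln (real d) / sqrt (real d)) * real (middle_layer_size (d + 1) n)))"
    by (intro exI[of _ C]) auto
qed

end
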